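(* In the fully-online setting, no deterministic algorithm for non-preemptive makespan minimization on two identical machines with testing is $c$-competitive for any $c<2.0953$.
   Context: Scheduling with testing on identical parallel machines: each job $j$ has a testing time $t_j\ge 0$, an upper bound $u_j\ge 0$ and a processing time $p_j$ with $0\le p_j\le u_j$. A job can either be run untested, occupying a machine for time $u_j$, or be tested and then executed, occupying a machine for total time $t_j+p_j$; the value $p_j$ is revealed to the algorithm only when the test of $j$ is completed. Fully-online setting: jobs arrive one by one; when job $j$ arrives its $t_j$ and $u_j$ are revealed, and the algorithm must irrevocably decide whether to test it and to which machine to assign it before the next job arrives. Non-preemptive: each job runs without interruption on its assigned machine. The objective is the makespan. $\mathrm{OPT}$ denotes the minimum makespan achievable by an offline scheduler knowing the whole instance including all $p_j$ (job $j$ needs time $\min(t_j+p_j,u_j)$ in the optimum). A deterministic algorithm is $c$-competitive if $\mathrm{ALG}\le c\cdot\mathrm{OPT}$ on every instance. *)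

theory Defs
  imports Complex_Main
begin

record job =
  test_time :: real
  upper_bound :: real
  proc_time :: real

definition valid_job :: "job \<Rightarrow> bool" where
  "valid_job j \<longleftrightarrow>
     0 \<le> test_time j \<and> 0 \<le> proc_time j \<and> proc_time j \<le> upper_bound j"

text \<open>A decision is a pair \<open>(tested, machine)\<close>; the machines are \<open>0, \<dots>, m - 1\<close>.\<close>

type_synonym decision = "bool \<times> nat"

definition occupied_time :: "job \<Rightarrow> bool \<Rightarrow> real" where
  "occupied_time j tested = (if tested then test_time j + proc_time j else upper_bound j)"

definition load :: "job list \<Rightarrow> decision list \<Rightarrow> nat \<Rightarrow> real" where
  "load js ds i =
     (\<Sum>k | k < length js \<and> snd (ds ! k) = i. occupied_time (js ! k) (fst (ds ! k)))"

text \<open>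
  All jobs are available from time \<open>0\<close>, so a machine completes the jobs assigned to it
  exactly at its load when it runs them back to back, and never earlier; see
  \<open>makespan_le_schedule\<close> and \<open>makespan_attained\<close> below.
\<close>

definition makespan :: "nat \<Rightarrow> job list \<Rightarrow> decision list \<Rightarrow> real" where
  "makespan m js ds = Max (load js ds ` {..<m})"

definition decisions :: "nat \<Rightarrow> job list \<Rightarrow> decision list set" where
  "decisions m js = {ds. length ds = length js \<and> (\<forall>d\<in>set ds. snd d < m)}"

definition opt :: "nat \<Rightarrow> job list \<Rightarrow> real" where
  "opt m js = Min (makespan m js ` decisions m js)"

text \<open>
  What the algorithm knows about an earlier job: testing time, upper bound, its own decision,
  and the processing time if and only if the job was tested.
\<close>

type_synonym observation = "real \<times> real \<times> decision \<times> real option"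

definition observe :: "job \<Rightarrow> decision \<Rightarrow> observation" where
  "observe j d =
     (test_time j, upper_bound j, d, if fst d then Some (proc_time j) else None)"

text \<open>
  A deterministic fully-online algorithm maps the observations of the earlier jobs (in order of
  arrival) and the testing time and upper bound of the arriving job to its decision on that job.
\<close>

type_synonym online_algorithm = "observation list \<Rightarrow> real \<Rightarrow> real \<Rightarrow> decision"

definition uses_machines :: "nat \<Rightarrow> online_algorithm \<Rightarrow> bool" where
  "uses_machines m A \<longleftrightarrow> (\<forall>h t u. snd (A h t u) < m)"

fun run_from :: "online_algorithm \<Rightarrow> observation list \<Rightarrow> job list \<Rightarrow> decision list" where
  "run_from A h [] = []"
| "run_from A h (j # js) =
     (let d = A h (test_time j) (upper_bound j)
      in d # run_from A (h @ [observe j d]) js)"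

definition alg_makespan :: "nat \<Rightarrow> online_algorithm \<Rightarrow> job list \<Rightarrow> real" where
  "alg_makespan m A js = makespan m js (run_from A [] js)"

definition competitive :: "nat \<Rightarrow> online_algorithm \<Rightarrow> real \<Rightarrow> bool" where
  "competitive m A c \<longleftrightarrow>
     (\<forall>js. (\<forall>j\<in>set js. valid_job j) \<longrightarrow> alg_makespan m A js \<le> c * opt m js)"


subsection \<open>Makespan and non-preemptive schedules with start times\<close>

text \<open>\<open>s k\<close> is the start time of the \<open>k\<close>-th job, and \<open>C\<close> a time by which all jobs are completed.\<close>

definition schedule :: "job list \<Rightarrow> decision list \<Rightarrow> (nat \<Rightarrow> real) \<Rightarrow> real \<Rightarrow> bool" where
  "schedule js ds s C \<longleftrightarrow>
     0 \<le> C \<and>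
     (\<forall>k<length js. 0 \<le> s k \<and> s k + occupied_time (js ! k) (fst (ds ! k)) \<le> C) \<and>
     (\<forall>k<length js. \<forall>l<length js. k \<noteq> l \<and> snd (ds ! k) = snd (ds ! l) \<longrightarrow>
        s k + occupied_time (js ! k) (fst (ds ! k)) \<le> s l \<or>
        s l + occupied_time (js ! l) (fst (ds ! l)) \<le> s k)"

lemma sum_lengths_le:
  fixes s d :: "nat \<Rightarrow> real"
  assumes "finite I" "0 \<le> C" "\<And>k. k \<in> I \<Longrightarrow> 0 \<le> s k \<and> 0 \<le> d k \<and> s k + d k \<le> C"
    and "\<And>k l. k \<in> I \<Longrightarrow> l \<in> I \<Longrightarrow> k \<noteq> l \<Longrightarrow> s k + d k \<le> s l \<or> s l + d l \<le> s k"
  shows "sum d I \<le> C"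
  using assms
proof (induction "card I" arbitrary: I C)
  case 0
  then show ?case by simp
next
  case (Suc n)
  then have "I \<noteq> {}" by auto
  have "Max (s ` I) \<in> s ` I" using Suc.prems(1) \<open>I \<noteq> {}\<close> by simp
  then obtain i where i: "i \<in> I" "s i = Max (s ` I)" by auto
  have mx: "s k \<le> s i" if "k \<in> I" for k
    using that i Suc.prems(1) by simp
  have n: "n = card (I - {i})" using Suc.hyps(2) i Suc.prems(1) by simp
  have split: "sum d I = d i + sum d (I - {i})"
    using i Suc.prems(1) by (simp add: sum.remove)
  have ord: "s k + d k \<le> s l \<or> s l + d l \<le> s k"
    if "k \<in> I - {i}" "l \<in> I - {i}" "k \<noteq> l" for k l
    using Suc.prems(4)[of k l] that by auto
  show ?case
  proof (cases "d i = 0")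
    case True
    have "sum d (I - {i}) \<le> C"
      by (rule Suc.hyps(1)[OF n _ Suc.prems(2)]) (use Suc.prems ord in auto)
    then show ?thesis using split True by simp
  next
    case False
    have "0 \<le> s k \<and> 0 \<le> d k \<and> s k + d k \<le> s i" if "k \<in> I - {i}" for k
      using Suc.prems(3)[of k] Suc.prems(3)[of i] Suc.prems(4)[of k i] mx[of k] that i False
      by force
    then have "sum d (I - {i}) \<le> s i"
      by (intro Suc.hyps(1)[OF n]) (use Suc.prems(1) Suc.prems(3)[OF i(1)] ord in auto)
    then show ?thesis using split Suc.prems(3)[of i] i by simp
  qed
qed

lemma occupied_time_nonneg: "valid_job j \<Longrightarrow> 0 \<le> occupied_time j b"
  by (auto simp: valid_job_def occupied_time_def)

lemma makespan_le_schedule: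
  assumes "0 < m" "\<forall>j\<in>set js. valid_job j" "schedule js ds s C"
  shows "makespan m js ds \<le> C"
proof -
  have "load js ds i \<le> C" for i
    unfolding load_def
    by (rule sum_lengths_le[where s = s])
      (use assms(2,3) in \<open>auto simp: schedule_def occupied_time_nonneg\<close>)
  moreover have "load js ds ` {..<m} \<noteq> {}" using assms(1) by auto
  ultimately show ?thesis unfolding makespan_def by (subst Max_le_iff) auto
qed

lemma makespan_attained:
  assumes "0 < m" "\<forall>j\<in>set js. valid_job j" "ds \<in> decisions m js"
  shows "\<exists>s. schedule js ds s (makespan m js ds)"
proof -
  define d where "d k = occupied_time (js ! k) (fst (ds ! k))" for k
  define s where "s k = (\<Sum>l | l < k \<and> snd (ds ! l) = snd (ds ! k). d l)" for k
  have d0: "0 \<le> d k" if "k < length js" for k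
    using that assms(2) by (simp add: d_def occupied_time_nonneg)
  have step: "s k + d k = (\<Sum>l | l \<le> k \<and> snd (ds ! l) = snd (ds ! k). d l)" for k
  proof -
    have "{l. l \<le> k \<and> snd (ds ! l) = snd (ds ! k)}
        = insert k {l. l < k \<and> snd (ds ! l) = snd (ds ! k)}" by auto
    then show ?thesis by (simp add: s_def)
  qed
  have seq: "s k + d k \<le> s l"
    if "k < l" "l < length js" "snd (ds ! k) = snd (ds ! l)" for k l
    unfolding step unfolding s_def
    by (rule sum_mono2) (use that d0 in auto)
  have load_le: "load js ds i \<le> makespan m js ds" if "i < m" for i
    unfolding makespan_def using that by simp
  have "s k + d k \<le> makespan m js ds" if k: "k < length js" for k
  proof -
    have "s k + d k \<le> load js ds (snd (ds ! k))"
      unfolding step load_def d_def[symmetric]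
      by (rule sum_mono2) (use k d0 in auto)
    also have "\<dots> \<le> makespan m js ds"
      using assms(3) k by (intro load_le) (auto simp: decisions_def)
    finally show ?thesis .
  qed
  moreover have "0 \<le> s k" if "k < length js" for k
    unfolding s_def by (rule sum_nonneg) (use that d0 in auto)
  moreover have "0 \<le> makespan m js ds"
  proof -
    have "0 \<le> load js ds 0"
      unfolding load_def d_def[symmetric] by (rule sum_nonneg) (use d0 in auto)
    then show ?thesis using load_le[of 0] assms(1) by simp
  qed
  moreover have "s k + d k \<le> s l \<or> s l + d l \<le> s k"
    if "k < length js" "l < length js" "k \<noteq> l" "snd (ds ! k) = snd (ds ! l)" for k l
    using seq[of k l] seq[of l k] that by (cases "k < l") auto
  ultimately show ?thesis unfolding schedule_def d_def by blast
qed

end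

theory Submission imports Defs begin

text \<open>
  The adversary fixes the processing time after the decision on the job: \<open>u\<close> if the job was
  tested, \<open>0\<close> otherwise, so that the optimum always takes the opposite testing decision.
  It first requests two jobs with \<open>t = 2\<close> and \<open>u = 4\<close>. If they share a machine, the ratio is at
  least \<open>10 / 4\<close>. Otherwise it requests a last job with \<open>t = s\<close> and \<open>u = s + 3\<close>, where \<open>s\<close> is the
  time that the optimum spends on the first two. The optimum runs these two on one machine and the
  last job on the other, whereas the algorithm must put the last job on top of one of the first two.
  The smallest ratio arises when the algorithm tests exactly one of the first two jobs and also the
  last one: then \<open>s = 6\<close> and the ratio is at least \<open>(4 + 15) / 9 = 19 / 9 > 2.11\<close>.
\<close>

lemma load_Nil [simp]: "load [] ds i = 0"
  by (simp add: load_def)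

lemma load_Cons [simp]:
  "load (j # js) (d # ds) i = (if snd d = i then occupied_time j (fst d) else 0) + load js ds i"
proof -
  have "load (j # js) (d # ds) i
      = (\<Sum>k<Suc (length js). if snd ((d # ds) ! k) = i
           then occupied_time ((j # js) ! k) (fst ((d # ds) ! k)) else 0)"
    unfolding load_def by (simp add: sum.inter_filter[symmetric] lessThan_def)
  also have "\<dots> = (if snd d = i then occupied_time j (fst d) else 0)
      + (\<Sum>k<length js. if snd (ds ! k) = i then occupied_time (js ! k) (fst (ds ! k)) else 0)"
    by (subst sum.lessThan_Suc_shift) (simp cong: if_cong)
  also have "(\<Sum>k<length js. if snd (ds ! k) = i
      then occupied_time (js ! k) (fst (ds ! k)) else 0) = load js ds i"
    unfolding load_def by (simp add: sum.inter_filter[symmetric] lessThan_def)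
  finally show ?thesis .
qed

lemma load_nonneg: "\<forall>j\<in>set js. valid_job j \<Longrightarrow> 0 \<le> load js ds i"
  unfolding load_def by (rule sum_nonneg) (simp add: occupied_time_nonneg)

lemma load_le_makespan: "i < m \<Longrightarrow> load js ds i \<le> makespan m js ds"
  unfolding makespan_def by simp

lemma makespan_two: "makespan 2 js ds = max (load js ds 0) (load js ds 1)"
proof -
  have "{..<2::nat} = {0, 1}" by auto
  then show ?thesis by (simp add: makespan_def)
qed

lemma finite_decisions: "finite (decisions m js)"
proof -
  have "decisions m js \<subseteq> {ds. set ds \<subseteq> UNIV \<times> {..<m} \<and> length ds = length js}"
    by (auto simp: decisions_def)
  then show ?thesis
    by (rule finite_subset) (simp add: finite_lists_length_eq)
qed

lemma opt_le_makespan: "ds \<in> decisions m js \<Longrightarrow> opt m js \<le> makespan m js ds"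
  unfolding opt_def by (simp add: finite_decisions)

lemma opt_nonneg:
  assumes "0 < m" "\<forall>j\<in>set js. valid_job j"
  shows "0 \<le> opt m js"
proof -
  have "replicate (length js) (True, 0) \<in> decisions m js"
    using assms(1) by (auto simp: decisions_def)
  moreover have "0 \<le> makespan m js ds" for ds
    using load_nonneg[OF assms(2)] load_le_makespan[OF assms(1)] by (rule order_trans)
  ultimately show ?thesis
    unfolding opt_def by (subst Min_ge_iff) (auto simp: finite_decisions)
qed

lemma competitive_mono:
  assumes "0 < m" "competitive m A c" "c \<le> c'"
  shows "competitive m A c'"
  unfolding competitive_def
proof (intro allI impI)
  fix js assume js: "\<forall>j\<in>set js. valid_job j"
  then have "alg_makespan m A js \<le> c * opt m js"
    using assms(2) by (simp add: competitive_def)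
  also have "\<dots> \<le> c' * opt m js"
    using assms(3) opt_nonneg[OF assms(1) js] by (rule mult_right_mono)
  finally show "alg_makespan m A js \<le> c' * opt m js" .
qed

lemma competitive_load_le:
  assumes "competitive m A c" "0 \<le> c" "\<forall>j\<in>set js. valid_job j" "i < m" "ds \<in> decisions m js"
  shows "load js (run_from A [] js) i \<le> c * makespan m js ds"
proof -
  have "load js (run_from A [] js) i \<le> alg_makespan m A js"
    unfolding alg_makespan_def using assms(4) by (rule load_le_makespan)
  also have "\<dots> \<le> c * opt m js"
    using assms(1,3) by (simp add: competitive_def)
  also have "\<dots> \<le> c * makespan m js ds"
    using opt_le_makespan[OF assms(5)] assms(2) by (rule mult_left_mono)
  finally show ?thesis .
qed

text \<open>A request is a pair \<open>(t, u)\<close>.\<close>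

definition adversarial_job :: "real \<times> real \<Rightarrow> bool \<Rightarrow> job" where
  "adversarial_job r tested =
     \<lparr>test_time = fst r, upper_bound = snd r, proc_time = (if tested then snd r else 0)\<rparr>"

lemma adversarial_job_sel [simp]:
  "test_time (adversarial_job r b) = fst r"
  "upper_bound (adversarial_job r b) = snd r"
  by (simp_all add: adversarial_job_def)

lemma valid_adversarial_job [simp]:
  "valid_job (adversarial_job r b) \<longleftrightarrow> 0 \<le> fst r \<and> 0 \<le> snd r"
  by (auto simp: adversarial_job_def valid_job_def)

definition online_time :: "real \<times> real \<Rightarrow> bool \<Rightarrow> real" where
  "online_time r tested = occupied_time (adversarial_job r tested) tested"

definition offline_time :: "real \<times> real \<Rightarrow> bool \<Rightarrow> real" where
  "offline_time r tested = occupied_time (adversarial_job r tested) (\<not> tested)"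

lemma online_time_eq: "online_time (t, u) b = (if b then t + u else u)"
  by (simp add: online_time_def occupied_time_def adversarial_job_def)

lemma offline_time_eq: "offline_time (t, u) b = (if b then u else t)"
  by (simp add: offline_time_def occupied_time_def adversarial_job_def)

fun responses :: "online_algorithm \<Rightarrow> observation list \<Rightarrow> (real \<times> real) list \<Rightarrow> decision list" where
  "responses A h [] = []"
| "responses A h (r # rs) =
     (let d = A h (fst r) (snd r)
      in d # responses A (h @ [observe (adversarial_job r (fst d)) d]) rs)"

definition adversarial_jobs :: "(real \<times> real) list \<Rightarrow> decision list \<Rightarrow> job list" where
  "adversarial_jobs rs ds = map2 (\<lambda>r d. adversarial_job r (fst d)) rs ds"

lemma adversarial_jobs_simps [simp]:
  "adversarial_jobs [] ds = []"
  "adversarial_jobs (r # rs) (d # ds) = adversarial_job r (fst d) # adversarial_jobs rs ds"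
  by (simp_all add: adversarial_jobs_def)

lemma run_from_adversarial_jobs:
  "run_from A h (adversarial_jobs rs (responses A h rs)) = responses A h rs"
  by (induction rs arbitrary: h) (simp_all add: Let_def)

lemma responses_snoc: "\<exists>d. responses A h (rs @ [r]) = responses A h rs @ [d]"
  by (induction rs arbitrary: h) (simp_all add: Let_def)

lemma responses_machine_less:
  assumes "uses_machines m A" "d \<in> set (responses A h rs)"
  shows "snd d < m"
  using assms by (induction rs arbitrary: h) (auto simp: Let_def uses_machines_def)

lemma competitive_responses_load_le:
  assumes "competitive m A c" "0 \<le> c"
    and nonneg: "\<forall>r\<in>set rs. 0 \<le> fst r \<and> 0 \<le> snd r"
    and responses: "responses A [] rs = ds"
    and "i < m" "ds' \<in> decisions m (adversarial_jobs rs ds)"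
  shows "load (adversarial_jobs rs ds) ds i \<le> c * makespan m (adversarial_jobs rs ds) ds'"
proof -
  have "\<forall>j\<in>set (adversarial_jobs rs ds). valid_job j"
    using nonneg by (fastforce simp: adversarial_jobs_def dest: set_zip_leftD)
  moreover have "run_from A [] (adversarial_jobs rs ds) = ds"
    using run_from_adversarial_jobs[of A "[]" rs] responses by simp
  ultimately show ?thesis
    using competitive_load_le[OF assms(1,2) _ assms(5,6)] by simp
qed

lemma competitive_same_machine:
  assumes "competitive 2 A c" "0 \<le> c" "uses_machines 2 A"
    and nonneg: "\<forall>r\<in>{r1, r2}. 0 \<le> fst r \<and> 0 \<le> snd r"
    and responses: "responses A [] [r1, r2] = [d1, d2]"
    and same_machine: "snd d1 = snd d2"
  shows "online_time r1 (fst d1) + online_time r2 (fst d2)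
    \<le> c * max (offline_time r1 (fst d1)) (offline_time r2 (fst d2))"
proof -
  let ?js = "adversarial_jobs [r1, r2] [d1, d2]"
  let ?ds = "[(\<not> fst d1, 0), (\<not> fst d2, 1)]"
  have "snd d1 < 2"
    using responses_machine_less[OF assms(3), of d1 "[]" "[r1, r2]"] responses by simp
  then have "load ?js [d1, d2] (snd d1) \<le> c * makespan 2 ?js ?ds"
    using nonneg
    by (intro competitive_responses_load_le[OF assms(1,2) _ responses]) (simp_all add: decisions_def)
  then show ?thesis
    using same_machine by (simp add: makespan_two online_time_def offline_time_def)
qed

lemma competitive_distinct_machines:
  assumes "competitive 2 A c" "0 \<le> c" "uses_machines 2 A"
    and nonneg: "\<forall>r\<in>{r1, r2, r3}. 0 \<le> fst r \<and> 0 \<le> snd r"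
    and responses: "responses A [] [r1, r2, r3] = [d1, d2, d3]"
    and distinct_machines: "snd d1 \<noteq> snd d2"
  shows "min (online_time r1 (fst d1)) (online_time r2 (fst d2)) + online_time r3 (fst d3)
    \<le> c * max (offline_time r1 (fst d1) + offline_time r2 (fst d2)) (offline_time r3 (fst d3))"
proof -
  let ?js = "adversarial_jobs [r1, r2, r3] [d1, d2, d3]"
  let ?ds = "[(\<not> fst d1, 0), (\<not> fst d2, 0), (\<not> fst d3, 1)]"
  have machines: "snd d1 < 2" "snd d2 < 2" "snd d3 < 2"
    using responses_machine_less[OF assms(3), of _ "[]" "[r1, r2, r3]"] responses by simp_all
  then have "snd d3 = snd d1 \<or> snd d3 = snd d2"
    using distinct_machines by linarith
  then have "min (online_time r1 (fst d1)) (online_time r2 (fst d2)) + online_time r3 (fst d3)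
      \<le> load ?js [d1, d2, d3] (snd d3)"
    using distinct_machines by (auto simp: online_time_def)
  also have "\<dots> \<le> c * makespan 2 ?js ?ds"
    using nonneg machines
    by (intro competitive_responses_load_le[OF assms(1,2) _ responses]) (simp_all add: decisions_def)
  also have "makespan 2 ?js ?ds
      = max (offline_time r1 (fst d1) + offline_time r2 (fst d2)) (offline_time r3 (fst d3))"
    by (simp add: makespan_two offline_time_def)
  finally show ?thesis .
qed

lemma competitive_two_machines_ge:
  assumes "competitive 2 A c" "0 \<le> c" "uses_machines 2 A"
  shows "19 / 9 \<le> c"
proof -
  let ?r = "(2, 4) :: real \<times> real"
  obtain d1 d2 where first_two: "responses A [] [?r, ?r] = [d1, d2]"
    by (simp add: Let_def)
  show ?thesis
  proof (cases "snd d1 = snd d2")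
    case True
    then have "online_time ?r (fst d1) + online_time ?r (fst d2)
        \<le> c * max (offline_time ?r (fst d1)) (offline_time ?r (fst d2))"
      by (intro competitive_same_machine[OF assms _ first_two]) simp_all
    then show ?thesis
      by (simp add: online_time_eq offline_time_eq split: if_splits)
  next
    case False
    define s where "s = offline_time ?r (fst d1) + offline_time ?r (fst d2)"
    obtain d3 where first_three: "responses A [] [?r, ?r, (s, s + 3)] = [d1, d2, d3]"
      using responses_snoc[of A "[]" "[?r, ?r]" "(s, s + 3)"] first_two by auto
    have "0 \<le> s"
      by (simp add: s_def offline_time_eq)
    then have
      "min (online_time ?r (fst d1)) (online_time ?r (fst d2)) + online_time (s, s + 3) (fst d3)
        \<le> c * max s (offline_time (s, s + 3) (fst d3))"
      using competitive_distinct_machines[OF assms _ first_three False] by (simp flip: s_def)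
    then show ?thesis
      by (simp add: s_def online_time_eq offline_time_eq split: if_splits)
  qed
qed

theorem theorem8:
  fixes c :: real
  assumes "c < 2.0953"
  shows "\<not> (\<exists>A :: online_algorithm. uses_machines 2 A \<and> competitive 2 A c)"
proof
  assume "\<exists>A :: online_algorithm. uses_machines 2 A \<and> competitive 2 A c"
  then obtain A where machines: "uses_machines 2 A" and "competitive 2 A c"
    by blast
  then have "competitive 2 A (max c 0)"
    by (intro competitive_mono[of 2 A c "max c 0"]) simp_all
  then have "19 / 9 \<le> max c 0"
    using machines by (intro competitive_two_machines_ge) simp_all
  then show False
    using assms by simp
qed

end
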